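(* Let $n\ge 1$, let $\alpha_1,\dots,\alpha_n\in\{-1,0\}$, and let $t$ be the number of indices $j$ with $\alpha_j=0$. Let $\mathcal L_t$ be the $2n$-dimensional complex Leibniz algebra with basis $\{f_1,\dots,f_n,x_1,\dots,x_n\}$ and multiplication $$[f_j,x_j]=f_j,\qquad [x_j,f_j]=\alpha_j f_j,\qquad 1\le j\le n,$$ all other products of basis elements being zero. Then every local derivation on $\mathcal L_t$ is a derivation.
   Context: A (right) Leibniz algebra is a vector space $\mathcal L$ with a bilinear bracket satisfying $[x,[y,z]]=[[x,y],z]-[[x,z],y]$ for all $x,y,z$. A derivation of $\mathcal L$ is a linear map $D:\mathcal L\to\mathcal L$ with $D([x,y])=[D(x),y]+[x,D(y)]$ for all $x,y\in\mathcal L$. A local derivation of $\mathcal L$ is a linear map $\Delta:\mathcal L\to\mathcal L$ such that for every $x\in\mathcal L$ there is a derivation $D_x$ of $\mathcal L$ (depending on $x$) with $\Delta(x)=D_x(x)$. *)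

theory Defs
  imports "HOL-Analysis.Analysis"
begin

text \<open>
  The constant \<open>linear\<close> of HOL-Analysis is real-linearity; linearity over the ground field is
  \<open>Vector_Spaces.linear\<close> with explicit scalar multiplications.
\<close>

locale leibniz_algebra = vector_space smul
  for smul :: "'k::field \<Rightarrow> 'a::ab_group_add \<Rightarrow> 'a" +
  fixes br :: "'a \<Rightarrow> 'a \<Rightarrow> 'a"
  assumes br_linear_left: "Vector_Spaces.linear smul smul (\<lambda>x. br x y)"
    and br_linear_right: "Vector_Spaces.linear smul smul (\<lambda>y. br x y)"
    and leibniz: "br x (br y z) = br (br x y) z - br (br x z) y"

definition derivation ::
  "('k::field \<Rightarrow> 'a::ab_group_add \<Rightarrow> 'a) \<Rightarrow> ('a \<Rightarrow> 'a \<Rightarrow> 'a) \<Rightarrow> ('a \<Rightarrow> 'a) \<Rightarrow> bool"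
  where "derivation smul br D \<longleftrightarrow>
    Vector_Spaces.linear smul smul D \<and> (\<forall>x y. D (br x y) = br (D x) y + br x (D y))"

definition local_derivation ::
  "('k::field \<Rightarrow> 'a::ab_group_add \<Rightarrow> 'a) \<Rightarrow> ('a \<Rightarrow> 'a \<Rightarrow> 'a) \<Rightarrow> ('a \<Rightarrow> 'a) \<Rightarrow> bool"
  where "local_derivation smul br \<Delta> \<longleftrightarrow>
    Vector_Spaces.linear smul smul \<Delta> \<and> (\<forall>x. \<exists>D. derivation smul br D \<and> \<Delta> x = D x)"

text \<open>
  The underlying vector space is the whole type \<open>'a\<close>. The families \<open>f\<close> and \<open>x\<close> only matter on the
  indices \<open>1, ..., n\<close>; the two injectivity conditions and the disjointness say that the basis
  has \<open>2 * n\<close> elements.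
\<close>

locale algebra_L = leibniz_algebra smul br
  for smul :: "complex \<Rightarrow> 'a::ab_group_add \<Rightarrow> 'a" and br :: "'a \<Rightarrow> 'a \<Rightarrow> 'a" +
  fixes n t :: nat and \<alpha> :: "nat \<Rightarrow> complex" and f x :: "nat \<Rightarrow> 'a"
  assumes n_pos: "n \<ge> 1"
    and alpha: "j \<in> {1..n} \<Longrightarrow> \<alpha> j \<in> {-1, 0}"
    and t_eq: "t = card {j \<in> {1..n}. \<alpha> j = 0}"
    and inj_f: "inj_on f {1..n}"
    and inj_x: "inj_on x {1..n}"
    and disjoint_f_x: "f ` {1..n} \<inter> x ` {1..n} = {}"
    and independent_basis: "independent (f ` {1..n} \<union> x ` {1..n})"
    and span_basis: "span (f ` {1..n} \<union> x ` {1..n}) = UNIV"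
    and br_f_x: "\<lbrakk>i \<in> {1..n}; j \<in> {1..n}\<rbrakk> \<Longrightarrow> br (f i) (x j) = (if i = j then f j else 0)"
    and br_x_f: "\<lbrakk>i \<in> {1..n}; j \<in> {1..n}\<rbrakk> \<Longrightarrow> br (x i) (f j) = (if i = j then smul (\<alpha> j) (f j) else 0)"
    and br_f_f: "\<lbrakk>i \<in> {1..n}; j \<in> {1..n}\<rbrakk> \<Longrightarrow> br (f i) (f j) = 0"
    and br_x_x: "\<lbrakk>i \<in> {1..n}; j \<in> {1..n}\<rbrakk> \<Longrightarrow> br (x i) (x j) = 0"

end

theory Submission
  imports Defs
begin

text \<open>
  The bracket forces every derivation \<open>D\<close> to be almost diagonal: \<open>D (f j) = \<kappa> j f j\<close> and
  \<open>D (x j) = \<mu> j f j\<close> with \<open>(1 + \<alpha> j) \<mu> j = 0\<close> (lemmas \<open>derivation_f\<close> and \<open>derivation_x\<close>).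
  Conversely, a linear map of this shape is a derivation for any choice of such scalars, because
  basis vectors with different indices have product zero, and so do their images
  (lemma \<open>derivation_if_acts_on_basis\<close>).

  Hence being a derivation is a condition on the value at each single basis vector. A local
  derivation agrees at each basis vector with some derivation, so it satisfies this condition at
  each of them and is itself a derivation.
\<close>

context algebra_L
begin

lemma br_add_left: "br (u + v) w = br u w + br v w"
  and br_smul_left: "br (smul c u) w = smul c (br u w)"
  and br_zero_left: "br 0 w = 0"
  and br_sum_left: "br (sum g A) w = (\<Sum>i\<in>A. br (g i) w)"
proof -
  interpret l: Vector_Spaces.linear smul smul "\<lambda>u. br u w" by (rule br_linear_left)
  show "br (u + v) w = br u w + br v w" by (rule l.add)
  show "br (smul c u) w = smul c (br u w)" by (rule l.scale)
  show "br 0 w = 0" by (rule l.zero)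
  show "br (sum g A) w = (\<Sum>i\<in>A. br (g i) w)" by (rule l.sum)
qed

lemma br_add_right: "br w (u + v) = br w u + br w v"
  and br_smul_right: "br w (smul c u) = smul c (br w u)"
  and br_zero_right: "br w 0 = 0"
  and br_sum_right: "br w (sum g A) = (\<Sum>i\<in>A. br w (g i))"
proof -
  interpret l: Vector_Spaces.linear smul smul "\<lambda>u. br w u" by (rule br_linear_right)
  show "br w (u + v) = br w u + br w v" by (rule l.add)
  show "br w (smul c u) = smul c (br w u)" by (rule l.scale)
  show "br w 0 = 0" by (rule l.zero)
  show "br w (sum g A) = (\<Sum>i\<in>A. br w (g i))" by (rule l.sum)
qed

lemma f_nonzero: "j \<in> {1..n} \<Longrightarrow> f j \<noteq> 0"
  using independent_basis dependent_zero by force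

lemma coordinates:
  obtains a b where "y = (\<Sum>i\<in>{1..n}. smul (a i) (f i)) + (\<Sum>i\<in>{1..n}. smul (b i) (x i))"
proof -
  have "y \<in> span (f ` {1..n} \<union> x ` {1..n})" using span_basis by simp
  then obtain u where "y = (\<Sum>v\<in>f ` {1..n} \<union> x ` {1..n}. smul (u v) v)"
    by (auto simp: span_finite)
  also have "\<dots> = (\<Sum>v\<in>f ` {1..n}. smul (u v) v) + (\<Sum>v\<in>x ` {1..n}. smul (u v) v)"
    by (rule sum.union_disjoint) (use disjoint_f_x in auto)
  also have "\<dots> = (\<Sum>i\<in>{1..n}. smul (u (f i)) (f i)) + (\<Sum>i\<in>{1..n}. smul (u (x i)) (x i))"
    by (simp only: sum.reindex[OF inj_f] sum.reindex[OF inj_x] o_def)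
  finally show thesis by (rule that)
qed

text \<open>
  Bracketing with \<open>f j\<close> or \<open>x j\<close> isolates one coordinate of a vector. These formulas turn each
  relation between basis vectors into an equation on the coordinates of their images under a
  derivation.
\<close>

lemma br_coordinates:
  assumes "y = (\<Sum>i\<in>{1..n}. smul (a i) (f i)) + (\<Sum>i\<in>{1..n}. smul (b i) (x i))"
    and j: "j \<in> {1..n}"
  shows "br y (x j) = smul (a j) (f j)"
    and "br (x j) y = smul (\<alpha> j * a j) (f j)"
    and "br (f j) y = smul (b j) (f j)"
proof -
  note expand = assms(1) br_add_left br_sum_left br_smul_left br_add_right br_sum_right br_smul_right
  have pick: "(\<Sum>i\<in>{1..n}. smul (c i) (if i = j then v else 0)) = smul (c j) v" for c v
  proof -
    have "(\<Sum>i\<in>{1..n}. smul (c i) (if i = j then v else 0)) = (\<Sum>i\<in>{1..n}. if i = j then smul (c i) v else 0)"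
      by (intro sum.cong) auto
    then show ?thesis using j by (simp add: sum.delta)
  qed
  have "br y (x j) = (\<Sum>i\<in>{1..n}. smul (a i) (if i = j then f j else 0))"
    using j by (simp add: expand br_f_x br_x_x)
  then show "br y (x j) = smul (a j) (f j)" by (simp only: pick)
  have "br (x j) y = (\<Sum>i\<in>{1..n}. smul (a i) (if i = j then smul (\<alpha> j) (f j) else 0))"
    using j by (simp add: expand br_x_f br_x_x) (auto intro!: sum.cong)
  then show "br (x j) y = smul (\<alpha> j * a j) (f j)" by (simp only: pick) (simp add: mult.commute)
  have "br (f j) y = (\<Sum>i\<in>{1..n}. smul (b i) (if i = j then f j else 0))"
    using j by (simp add: expand br_f_f br_f_x) (auto intro!: sum.cong)
  then show "br (f j) y = smul (b j) (f j)" by (simp only: pick)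
qed

text \<open>
  Since \<open>f j = [f j, x j]\<close>, the image of \<open>f j\<close> is a sum of brackets with \<open>x j\<close> on the right and
  with \<open>f j\<close> on the left, and both lie on the line through \<open>f j\<close>.
\<close>

lemma derivation_f:
  assumes D: "derivation smul br D" and j: "j \<in> {1..n}"
  obtains c where "D (f j) = smul c (f j)"
proof -
  obtain a b where y: "D (f j) = (\<Sum>i\<in>{1..n}. smul (a i) (f i)) + (\<Sum>i\<in>{1..n}. smul (b i) (x i))"
    by (rule coordinates)
  obtain a' b' where z: "D (x j) = (\<Sum>i\<in>{1..n}. smul (a' i) (f i)) + (\<Sum>i\<in>{1..n}. smul (b' i) (x i))"
    by (rule coordinates)
  have "D (f j) = D (br (f j) (x j))" using br_f_x j by simp
  also have "\<dots> = br (D (f j)) (x j) + br (f j) (D (x j))" using D by (simp add: derivation_def)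
  also have "\<dots> = smul (a j + b' j) (f j)"
    using br_coordinates[OF y j] br_coordinates[OF z j] by (simp add: scale_left_distrib)
  finally show thesis by (rule that)
qed

text \<open>
  The products \<open>[f i, x j]\<close> remove the \<open>x\<close>-part of the image of \<open>x j\<close>, the products \<open>[x j, x i]\<close>
  with \<open>i \<noteq> j\<close> remove its \<open>f i\<close>-part, and \<open>[x j, x j] = 0\<close> gives the remaining constraint.
\<close>

lemma derivation_x:
  assumes D: "derivation smul br D" and j: "j \<in> {1..n}"
  obtains c where "D (x j) = smul c (f j)" and "(1 + \<alpha> j) * c = 0"
proof -
  have lin: "Vector_Spaces.linear smul smul D"
    and prod: "\<And>u v. D (br u v) = br (D u) v + br u (D v)"
    using D by (auto simp: derivation_def)
  interpret D: Vector_Spaces.linear smul smul D by (rule lin)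
  obtain a b where y: "D (x j) = (\<Sum>i\<in>{1..n}. smul (a i) (f i)) + (\<Sum>i\<in>{1..n}. smul (b i) (x i))"
    by (rule coordinates)
  have b0: "b i = 0" if i: "i \<in> {1..n}" for i
  proof -
    obtain c where c: "D (f i) = smul c (f i)" using derivation_f[OF D i] .
    have "D (br (f i) (x j)) = br (D (f i)) (x j) + smul (b i) (f i)"
      using prod[of "f i" "x j"] br_coordinates(3)[OF y i] by simp
    moreover have "D (br (f i) (x j)) = br (D (f i)) (x j)"
      using i j c by (auto simp: br_smul_left br_f_x D.zero)
    ultimately show ?thesis using f_nonzero[OF i] by simp
  qed
  have a0: "a i = 0" if i: "i \<in> {1..n}" and ij: "i \<noteq> j" for i
  proof -
    obtain a' b' where z: "D (x i) = (\<Sum>i\<in>{1..n}. smul (a' i) (f i)) + (\<Sum>i\<in>{1..n}. smul (b' i) (x i))"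
      by (rule coordinates)
    have "0 = br (D (x j)) (x i) + br (x j) (D (x i))"
      using prod[of "x j" "x i"] i j by (simp add: br_x_x D.zero)
    also have "\<dots> = smul (a i) (f i) + smul (\<alpha> j * a' j) (f j)"
      using br_coordinates(1)[OF y i] br_coordinates(2)[OF z j] by simp
    finally have "0 = smul (a i) (f i) + smul (\<alpha> j * a' j) (f j)" .
    \<comment> \<open>Bracketing with \<open>x i\<close> kills the term in \<open>f j\<close>.\<close>
    then have "br 0 (x i) = br (smul (a i) (f i) + smul (\<alpha> j * a' j) (f j)) (x i)" by simp
    then have "smul (a i) (f i) = 0"
      using i j ij by (simp add: br_zero_left br_add_left br_smul_left br_f_x)
    then show ?thesis using f_nonzero[OF i] by simp
  qed
  have "D (x j) = (\<Sum>i\<in>{1..n}. smul (a i) (f i))"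
    using y b0 by simp
  also have "\<dots> = (\<Sum>i\<in>{1..n}. if i = j then smul (a i) (f i) else 0)"
    using a0 by (intro sum.cong) auto
  also have "\<dots> = smul (a j) (f j)" using j by (simp add: sum.delta)
  finally have Dx: "D (x j) = smul (a j) (f j)" .
  have "0 = br (D (x j)) (x j) + br (x j) (D (x j))"
    using prod[of "x j" "x j"] j by (simp add: br_x_x D.zero)
  also have "\<dots> = smul (a j + \<alpha> j * a j) (f j)"
    using br_coordinates[OF y j] by (simp add: scale_left_distrib)
  finally have "a j + \<alpha> j * a j = 0"
    using f_nonzero[OF j] by (metis scale_eq_0_iff)
  then have "(1 + \<alpha> j) * a j = 0" by (simp add: distrib_right)
  with Dx show thesis by (rule that)
qed

lemma linear_product_rule_on_basis:
  assumes lin: "Vector_Spaces.linear smul smul D"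
    and basis: "\<And>u v. u \<in> f ` {1..n} \<union> x ` {1..n} \<Longrightarrow> v \<in> f ` {1..n} \<union> x ` {1..n} \<Longrightarrow>
      D (br u v) = br (D u) v + br u (D v)"
  shows "derivation smul br D"
proof -
  interpret D: Vector_Spaces.linear smul smul D by (rule lin)
  note expand = br_add_left br_smul_left br_zero_left br_add_right br_smul_right br_zero_right
    D.add D.scale D.zero scale_right_distrib
  have right: "D (br u v) = br (D u) v + br u (D v)"
    if u: "u \<in> f ` {1..n} \<union> x ` {1..n}" for u v
  proof -
    have "v \<in> span (f ` {1..n} \<union> x ` {1..n})" using span_basis by simp
    then show ?thesis
      by (induction v rule: span_induct_alt) (use basis[OF u] in \<open>simp_all add: expand\<close>)
  qed
  have "D (br u v) = br (D u) v + br u (D v)" for u v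
  proof -
    have "u \<in> span (f ` {1..n} \<union> x ` {1..n})" using span_basis by simp
    then show ?thesis
      by (induction u rule: span_induct_alt) (use right in \<open>simp_all add: expand\<close>)
  qed
  then show ?thesis using lin by (simp add: derivation_def)
qed

text \<open>
  On the products of basis vectors the scalars \<open>\<kappa> j\<close> cancel, and the scalars \<open>\<mu> j\<close> enter only
  through \<open>[x j, x j]\<close>, in the combination \<open>(1 + \<alpha> j) \<mu> j\<close>.
\<close>

lemma derivation_if_acts_on_basis:
  assumes lin: "Vector_Spaces.linear smul smul D"
    and Df: "\<And>j. j \<in> {1..n} \<Longrightarrow> D (f j) = smul (\<kappa> j) (f j)"
    and Dx: "\<And>j. j \<in> {1..n} \<Longrightarrow> D (x j) = smul (\<mu> j) (f j)"
    and constraint: "\<And>j. j \<in> {1..n} \<Longrightarrow> (1 + \<alpha> j) * \<mu> j = 0"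
  shows "derivation smul br D"
proof (rule linear_product_rule_on_basis[OF lin])
  interpret D: Vector_Spaces.linear smul smul D by (rule lin)
  note expand = Df Dx br_f_f br_f_x br_x_f br_x_x br_smul_left br_smul_right D.scale D.zero
  have ff: "D (br (f i) (f j)) = br (D (f i)) (f j) + br (f i) (D (f j))"
    and fx: "D (br (f i) (x j)) = br (D (f i)) (x j) + br (f i) (D (x j))"
    and xf: "D (br (x i) (f j)) = br (D (x i)) (f j) + br (x i) (D (f j))"
    and xx: "D (br (x i) (x j)) = br (D (x i)) (x j) + br (x i) (D (x j))"
    if i: "i \<in> {1..n}" and j: "j \<in> {1..n}" for i j
  proof -
    show "D (br (f i) (f j)) = br (D (f i)) (f j) + br (f i) (D (f j))"
      and "D (br (f i) (x j)) = br (D (f i)) (x j) + br (f i) (D (x j))"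
      and "D (br (x i) (f j)) = br (D (x i)) (f j) + br (x i) (D (f j))"
      using i j by (auto simp: expand mult.commute)
    have "smul (\<mu> j) (f j) + smul (\<mu> j * \<alpha> j) (f j) = 0"
      using constraint[OF j] by (simp flip: scale_left_distrib add: algebra_simps)
    then show "D (br (x i) (x j)) = br (D (x i)) (x j) + br (x i) (D (x j))"
      using i j by (auto simp: expand)
  qed
  show "D (br u v) = br (D u) v + br u (D v)"
    if "u \<in> f ` {1..n} \<union> x ` {1..n}" "v \<in> f ` {1..n} \<union> x ` {1..n}" for u v
    using that ff fx xf xx by blast
qed

end

theorem theorem3p2:
  fixes smul :: "complex \<Rightarrow> 'a::ab_group_add \<Rightarrow> 'a" and br :: "'a \<Rightarrow> 'a \<Rightarrow> 'a"
    and n t :: nat and \<alpha> :: "nat \<Rightarrow> complex" and f x :: "nat \<Rightarrow> 'a"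
    and \<Delta> :: "'a \<Rightarrow> 'a"
  assumes "algebra_L smul br n t \<alpha> f x"
    and "local_derivation smul br \<Delta>"
  shows "derivation smul br \<Delta>"
proof -
  interpret algebra_L smul br n t \<alpha> f x by (rule assms(1))
  have lin: "Vector_Spaces.linear smul smul \<Delta>"
    and loc: "\<And>y. \<exists>D. derivation smul br D \<and> \<Delta> y = D y"
    using assms(2) by (auto simp: local_derivation_def)
  have "\<exists>c. \<Delta> (f j) = smul c (f j)" if "j \<in> {1..n}" for j
    using loc[of "f j"] derivation_f[OF _ that] by metis
  then obtain \<kappa> where \<Delta>f: "\<And>j. j \<in> {1..n} \<Longrightarrow> \<Delta> (f j) = smul (\<kappa> j) (f j)"
    by metis
  have "\<exists>c. \<Delta> (x j) = smul c (f j) \<and> (1 + \<alpha> j) * c = 0" if "j \<in> {1..n}" for j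
    using loc[of "x j"] derivation_x[OF _ that] by metis
  then obtain \<mu> where \<Delta>x: "\<And>j. j \<in> {1..n} \<Longrightarrow> \<Delta> (x j) = smul (\<mu> j) (f j)"
    and constraint: "\<And>j. j \<in> {1..n} \<Longrightarrow> (1 + \<alpha> j) * \<mu> j = 0"
    by metis
  show ?thesis
    by (rule derivation_if_acts_on_basis[OF lin \<Delta>f \<Delta>x constraint])
qed

end
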